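(* For a $T_4$ space $X$, the ring $B_1^*(X)$ is isomorphic to the ring $C(\mathcal{M}(B_1(X)))$. In other words, for a $T_4$ space $X$, $B_1^*(X)$ is a C-type ring.
   Context: A $T_4$ space is a normal $T_1$ space. $B_1(X)$ is the ring of Baire one functions on $X$, i.e. pointwise limits of sequences of continuous functions $X\to\mathbb{R}$; $B_1^*(X)$ is its subring of bounded functions. $\mathcal{M}(B_1(X))$ is the set of all maximal ideals of $B_1(X)$ with the hull-kernel topology: the sets $\{\widehat{M}\in\mathcal{M}(B_1(X)): f\in\widehat{M}\}$, $f\in B_1(X)$, form a base for closed sets. $C(T)$ is the ring of continuous real-valued functions on a space $T$. A ring is a C-type ring if it is isomorphic to $C(T)$ for some topological space $T$. *)

theory Defs
  imports "HOL-Analysis.Analysis" "HOL-Algebra.QuotRing"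
begin

text \<open>
  Topological spaces are abstract topologies with carrier \<open>topspace X\<close>, so a real-valued
  function on \<open>X\<close> is represented by its unique representative in \<open>extensional (topspace X)\<close>.
\<close>

definition T4_space :: "'a topology \<Rightarrow> bool"
  where "T4_space X \<longleftrightarrow> normal_space X \<and> t1_space X"

definition fun_ring :: "'a set \<Rightarrow> ('a \<Rightarrow> real) set \<Rightarrow> ('a \<Rightarrow> real) ring"
  where "fun_ring S A =
    \<lparr>carrier = A,
     mult = (\<lambda>f g. \<lambda>x\<in>S. f x * g x),
     one = (\<lambda>x\<in>S. 1),
     zero = (\<lambda>x\<in>S. 0),
     add = (\<lambda>f g. \<lambda>x\<in>S. f x + g x)\<rparr>"

definition C_ring :: "'a topology \<Rightarrow> ('a \<Rightarrow> real) ring"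
  where "C_ring T = fun_ring (topspace T)
    {f \<in> extensional (topspace T). continuous_map T euclideanreal f}"

definition baire_one :: "'a topology \<Rightarrow> ('a \<Rightarrow> real) \<Rightarrow> bool"
  where "baire_one X f \<longleftrightarrow>
    (\<exists>F :: nat \<Rightarrow> 'a \<Rightarrow> real. (\<forall>n. continuous_map X euclideanreal (F n)) \<and>
       (\<forall>x\<in>topspace X. (\<lambda>n. F n x) \<longlonglongrightarrow> f x))"

definition B1_ring :: "'a topology \<Rightarrow> ('a \<Rightarrow> real) ring"
  where "B1_ring X = fun_ring (topspace X) {f \<in> extensional (topspace X). baire_one X f}"

definition B1_bounded_ring :: "'a topology \<Rightarrow> ('a \<Rightarrow> real) ring"
  where "B1_bounded_ring X = fun_ring (topspace X)
    {f \<in> extensional (topspace X). baire_one X f \<and> bounded (f ` topspace X)}"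

text \<open>
  The hull-kernel topology, given by the base of open sets complementary to the closed base
  \<open>{M. maximalideal M R \<and> f \<in> M}\<close>; see \<open>closedin_maximal_ideal_space\<close> below.
\<close>

definition maximal_ideal_space :: "('r, 'm) ring_scheme \<Rightarrow> 'r set topology"
  where "maximal_ideal_space R = topology (arbitrary union_of
    (\<lambda>U. \<exists>f\<in>carrier R. U = {M. maximalideal M R \<and> f \<notin> M}))"

text \<open>
  HOL cannot quantify over the type of points of the representing space, so that type is an
  explicit parameter: \<open>R\<close> is a C-type ring iff \<open>C_type_ring TYPE('t) R\<close> holds for some type \<open>'t\<close>.
\<close>

definition C_type_ring :: "'t itself \<Rightarrow> ('r, 'm) ring_scheme \<Rightarrow> bool"
  where "C_type_ring _ R \<longleftrightarrow> (\<exists>T :: 't topology. R \<simeq> C_ring T)"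


lemma cring_fun_ring:
  assumes ext: "A \<subseteq> extensional S"
    and one: "(\<lambda>x\<in>S. 1) \<in> A"
    and add: "\<And>f g. f \<in> A \<Longrightarrow> g \<in> A \<Longrightarrow> (\<lambda>x\<in>S. f x + g x) \<in> A"
    and mult: "\<And>f g. f \<in> A \<Longrightarrow> g \<in> A \<Longrightarrow> (\<lambda>x\<in>S. f x * g x) \<in> A"
    and neg: "\<And>f. f \<in> A \<Longrightarrow> (\<lambda>x\<in>S. - f x) \<in> A"
  shows "cring (fun_ring S A)"
proof -
  have "(\<lambda>x\<in>S. (\<lambda>x\<in>S. 1) x + (\<lambda>x\<in>S. - (\<lambda>x\<in>S. 1::real) x) x) \<in> A"
    by (intro add neg one)
  moreover have "(\<lambda>x\<in>S. (\<lambda>x\<in>S. 1) x + (\<lambda>x\<in>S. - (\<lambda>x\<in>S. 1::real) x) x) = (\<lambda>x\<in>S. 0)"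
    by (auto simp: restrict_def)
  ultimately have zero: "(\<lambda>x\<in>S. 0) \<in> A"
    by simp
  have E: "(\<lambda>x\<in>S. f x) = f" if "f \<in> A" for f
    using ext that by (auto intro: extensional_restrict)
  let ?R = "fun_ring S A"
  have abel: "abelian_group ?R"
  proof (rule abelian_groupI)
    fix f assume "f \<in> carrier ?R"
    then show "\<exists>g\<in>carrier ?R. g \<oplus>\<^bsub>?R\<^esub> f = \<zero>\<^bsub>?R\<^esub>"
      by (intro bexI[of _ "\<lambda>x\<in>S. - f x"]) (auto simp: fun_ring_def neg fun_eq_iff)
  next
    fix f assume "f \<in> carrier ?R"
    then have "f \<in> A"
      by (simp add: fun_ring_def)
    have "(\<lambda>x\<in>S. (\<lambda>x\<in>S. 0) x + f x) = (\<lambda>x\<in>S. f x)"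
      by (rule restrict_ext) simp
    then show "\<zero>\<^bsub>?R\<^esub> \<oplus>\<^bsub>?R\<^esub> f = f"
      using E[OF \<open>f \<in> A\<close>] by (simp add: fun_ring_def)
  qed (auto simp: fun_ring_def zero add fun_eq_iff)
  have mon: "comm_monoid ?R"
  proof (rule comm_monoidI)
    fix f assume "f \<in> carrier ?R"
    then have "f \<in> A"
      by (simp add: fun_ring_def)
    have "(\<lambda>x\<in>S. (\<lambda>x\<in>S. 1) x * f x) = (\<lambda>x\<in>S. f x)"
      by (rule restrict_ext) simp
    then show "\<one>\<^bsub>?R\<^esub> \<otimes>\<^bsub>?R\<^esub> f = f"
      using E[OF \<open>f \<in> A\<close>] by (simp add: fun_ring_def)
  qed (auto simp: fun_ring_def one mult fun_eq_iff)
  show ?thesis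
    by (rule cringI[OF abel mon]) (auto simp: fun_ring_def fun_eq_iff algebra_simps)
qed

lemma cring_C_ring: "cring (C_ring T)"
proof -
  have [simp]: "continuous_map T euclideanreal (restrict f (topspace T)) \<longleftrightarrow>
      continuous_map T euclideanreal f" for f
    by (metis continuous_map_eq restrict_apply')
  show ?thesis
    unfolding C_ring_def
    by (rule cring_fun_ring)
       (auto intro: continuous_map_add continuous_map_real_mult continuous_map_minus)
qed

lemma baire_one_restrict [simp]: "baire_one X (restrict f (topspace X)) \<longleftrightarrow> baire_one X f"
  by (simp add: baire_one_def)

lemma baire_one_const [simp]: "baire_one X (\<lambda>x. c)"
  unfolding baire_one_def by (rule exI[of _ "\<lambda>n x. c"]) auto

lemma baire_one_minus: "baire_one X f \<Longrightarrow> baire_one X (\<lambda>x. - f x)"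
  unfolding baire_one_def
  by (elim exE, rule_tac x = "\<lambda>n x. - F n x" in exI)
     (auto intro: tendsto_minus continuous_map_minus)

lemma baire_one_add: "baire_one X f \<Longrightarrow> baire_one X g \<Longrightarrow> baire_one X (\<lambda>x. f x + g x)"
  unfolding baire_one_def
  by (elim exE, rule_tac x = "\<lambda>n x. F n x + Fa n x" in exI)
     (auto intro: tendsto_add continuous_map_add)

lemma baire_one_mult: "baire_one X f \<Longrightarrow> baire_one X g \<Longrightarrow> baire_one X (\<lambda>x. f x * g x)"
  unfolding baire_one_def
  by (elim exE, rule_tac x = "\<lambda>n x. F n x * Fa n x" in exI)
     (auto intro: tendsto_mult continuous_map_real_mult)

lemma cring_B1_ring: "cring (B1_ring X)"
  unfolding B1_ring_def
  by (rule cring_fun_ring) (auto intro: baire_one_add baire_one_mult baire_one_minus)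

lemma bounded_fun_mult:
  fixes f g :: "'a \<Rightarrow> real"
  assumes "bounded (f ` S)" "bounded (g ` S)"
  shows "bounded ((\<lambda>x. f x * g x) ` S)"
proof -
  obtain a b where "\<forall>x\<in>S. \<bar>f x\<bar> \<le> a" "\<forall>x\<in>S. \<bar>g x\<bar> \<le> b"
    using assms by (auto simp: bounded_iff)
  then have "\<forall>x\<in>S. \<bar>f x * g x\<bar> \<le> a * b"
    by (auto simp: abs_mult intro!: mult_mono intro: order_trans[OF abs_ge_zero])
  then show ?thesis
    by (auto simp: bounded_iff)
qed

lemma cring_B1_bounded_ring: "cring (B1_bounded_ring X)"
  unfolding B1_bounded_ring_def
proof (rule cring_fun_ring)
  fix f g :: "'a \<Rightarrow> real"
  assume "f \<in> {f \<in> extensional (topspace X). baire_one X f \<and> bounded (f ` topspace X)}"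
    and "g \<in> {f \<in> extensional (topspace X). baire_one X f \<and> bounded (f ` topspace X)}"
  then show "(\<lambda>x\<in>topspace X. f x + g x)
        \<in> {f \<in> extensional (topspace X). baire_one X f \<and> bounded (f ` topspace X)}"
    and "(\<lambda>x\<in>topspace X. f x * g x)
        \<in> {f \<in> extensional (topspace X). baire_one X f \<and> bounded (f ` topspace X)}"
    by (auto intro: baire_one_add baire_one_mult bounded_plus_comp bounded_fun_mult)
qed (auto intro: baire_one_minus bounded_minus_comp simp: image_constant_conv)

context cring
begin

lemma openin_maximal_ideal_space:
  "openin (maximal_ideal_space R) =
     arbitrary union_of (\<lambda>U. \<exists>f\<in>carrier R. U = {M. maximalideal M R \<and> f \<notin> M})"
  unfolding maximal_ideal_space_def
proof (rule topology_inverse', rule istopology_base)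
  fix S T
  assume S: "\<exists>f\<in>carrier R. S = {M. maximalideal M R \<and> f \<notin> M}"
    and T: "\<exists>f\<in>carrier R. T = {M. maximalideal M R \<and> f \<notin> M}"
  from S obtain f where f: "f \<in> carrier R" "S = {M. maximalideal M R \<and> f \<notin> M}" ..
  from T obtain g where g: "g \<in> carrier R" "T = {M. maximalideal M R \<and> g \<notin> M}" ..
  have "f \<otimes> g \<in> M \<longleftrightarrow> f \<in> M \<or> g \<in> M" if "maximalideal M R" for M
  proof -
    interpret primeideal M R
      using that by (rule maximalideal_prime)
    show ?thesis
      using I_prime[OF f(1) g(1)] I_l_closed[OF _ f(1), of g] I_r_closed[OF _ g(1), of f] by blast
  qed
  then show "\<exists>h\<in>carrier R. S \<inter> T = {M. maximalideal M R \<and> h \<notin> M}"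
    using f g by (intro bexI[of _ "f \<otimes> g"]) auto
qed

lemma topspace_maximal_ideal_space: "topspace (maximal_ideal_space R) = {M. maximalideal M R}"
proof
  show "topspace (maximal_ideal_space R) \<subseteq> {M. maximalideal M R}"
    by (auto simp: topspace_def openin_maximal_ideal_space union_of_def)
  have "{M. maximalideal M R} = {M. maximalideal M R \<and> \<one> \<notin> M}"
    using ideal.one_imp_carrier maximalideal.axioms(1) maximalideal.I_notcarr by blast
  then have "openin (maximal_ideal_space R) {M. maximalideal M R}"
    unfolding openin_maximal_ideal_space
    by (intro arbitrary_union_of_inc) blast
  then show "{M. maximalideal M R} \<subseteq> topspace (maximal_ideal_space R)"
    by (rule openin_subset)
qed

lemma closedin_maximal_ideal_space:
  "closedin (maximal_ideal_space R) C \<longleftrightarrow>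
     (\<exists>F\<subseteq>carrier R. C = {M. maximalideal M R} \<inter> (\<Inter>f\<in>F. {M. maximalideal M R \<and> f \<in> M}))"
proof
  assume "closedin (maximal_ideal_space R) C"
  then have C: "C \<subseteq> {M. maximalideal M R}"
    and "openin (maximal_ideal_space R) ({M. maximalideal M R} - C)"
    by (auto simp: closedin_def topspace_maximal_ideal_space)
  then obtain \<U> where
    sub: "\<U> \<subseteq> Collect (\<lambda>U. \<exists>f\<in>carrier R. U = {M. maximalideal M R \<and> f \<notin> M})"
    and eq: "\<Union>\<U> = {M. maximalideal M R} - C"
    unfolding openin_maximal_ideal_space union_of_def by (elim exE conjE)
  have U: "\<exists>f\<in>carrier R. U = {M. maximalideal M R \<and> f \<notin> M}" if "U \<in> \<U>" for U
    using subsetD[OF sub that] by (rule CollectD)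
  define F where "F = {f \<in> carrier R. {M. maximalideal M R \<and> f \<notin> M} \<in> \<U>}"
  have "M \<in> C \<longleftrightarrow> (\<forall>f\<in>F. f \<in> M)" if M: "maximalideal M R" for M
  proof -
    have "M \<in> C \<longleftrightarrow> M \<notin> \<Union>\<U>"
      using M eq by blast
    also have "\<dots> \<longleftrightarrow> (\<forall>f\<in>F. f \<in> M)"
    proof
      assume "M \<notin> \<Union>\<U>"
      then show "\<forall>f\<in>F. f \<in> M"
        using M by (auto simp: F_def)
    next
      assume F: "\<forall>f\<in>F. f \<in> M"
      show "M \<notin> \<Union>\<U>"
      proof
        assume "M \<in> \<Union>\<U>"
        then obtain U where "U \<in> \<U>" "M \<in> U" ..
        moreover from U[OF \<open>U \<in> \<U>\<close>] obtain f
          where "f \<in> carrier R" "U = {M. maximalideal M R \<and> f \<notin> M}" ..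
        ultimately show False
          using F by (auto simp: F_def)
      qed
    qed
    finally show ?thesis .
  qed
  then have "C = {M. maximalideal M R} \<inter> (\<Inter>f\<in>F. {M. maximalideal M R \<and> f \<in> M})"
    using C by auto
  then show "\<exists>F\<subseteq>carrier R.
      C = {M. maximalideal M R} \<inter> (\<Inter>f\<in>F. {M. maximalideal M R \<and> f \<in> M})"
    by (intro exI[of _ F]) (auto simp: F_def)
next
  assume "\<exists>F\<subseteq>carrier R. C = {M. maximalideal M R} \<inter> (\<Inter>f\<in>F. {M. maximalideal M R \<and> f \<in> M})"
  then obtain F where F: "F \<subseteq> carrier R"
    and C: "C = {M. maximalideal M R} \<inter> (\<Inter>f\<in>F. {M. maximalideal M R \<and> f \<in> M})"
    by (elim exE conjE)
  have "openin (maximal_ideal_space R) {M. maximalideal M R \<and> f \<notin> M}" if "f \<in> F" for f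
    unfolding openin_maximal_ideal_space
    using F that by (intro arbitrary_union_of_inc) blast
  then have "openin (maximal_ideal_space R) (\<Union>f\<in>F. {M. maximalideal M R \<and> f \<notin> M})"
    by blast
  moreover have "{M. maximalideal M R} - C = (\<Union>f\<in>F. {M. maximalideal M R \<and> f \<notin> M})"
    using C by auto
  ultimately show "closedin (maximal_ideal_space R) C"
    using C by (auto simp: closedin_def topspace_maximal_ideal_space)
qed

end

end

theory Submission
  imports Defs "HOL-Algebra.Ring_Divisibility"
begin

text \<open>
  A point \<open>x\<close> of \<open>X\<close> gives the maximal ideal \<open>M\<^sub>x\<close> of the Baire one functions that vanish at \<open>x\<close>. A
  continuous function \<open>\<phi>\<close> on the maximal ideal space therefore restricts to the function
  \<open>x \<mapsto> \<phi> M\<^sub>x\<close> on \<open>X\<close>, and restriction respects the pointwise ring operations. The claim is that this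
  restriction is a bijection onto the bounded Baire one functions.

  Every bounded Baire one function \<open>f\<close> extends. The zero sets of the members of a maximal ideal \<open>M\<close>
  generate a filter. It is proper because a nowhere vanishing Baire one function is invertible, and
  because \<open>M\<close> is prime it decides for every real \<open>c\<close> whether \<open>f \<le> c\<close> or \<open>f \<ge> c\<close>. So \<open>f\<close> has a limit
  along it (\<open>bounded_baire_one_convergent\<close>). The limit depends continuously on \<open>M\<close>
  (\<open>continuous_map_ideal_limit\<close>) and equals \<open>f x\<close> at \<open>M\<^sub>x\<close> (\<open>ideal_limit_point_ideal\<close>).

  Conversely, let \<open>\<phi>\<close> be continuous and \<open>a < b\<close>. The closed sets \<open>\<phi> \<le> a\<close> and \<open>\<phi> \<ge> b\<close> are hulls of
  ideals that lie in no common maximal ideal, so \<open>1 = g + h\<close> with \<open>g\<close> in every member of the first set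
  and \<open>h\<close> in every member of the second (\<open>separate_levels\<close>). This separation of levels has three
  consequences. The restriction of \<open>\<phi>\<close> tends to \<open>\<phi> M\<close> along the filter of \<open>M\<close>, so \<open>\<phi>\<close> is the extension
  of its restriction (\<open>tendsto_at_maximalideal\<close>). The restriction is bounded, since otherwise the
  functions vanishing where it is large would lie in a maximal ideal at which \<open>\<phi>\<close> could have no finite
  value (\<open>bounded_above_on_point_ideals\<close>). Finally it is Baire one: truncated separating functions add
  up to uniform approximations (\<open>baire_one_if_levels_separated\<close>), and the Baire one functions are closed
  under uniform limits (\<open>baire_one_uniform_limit\<close>).
\<close>

section \<open>Closure properties of the Baire one functions\<close>

lemma baire_one_diff: "baire_one X f \<Longrightarrow> baire_one X g \<Longrightarrow> baire_one X (\<lambda>x. f x - g x)"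
  using baire_one_add[of X f "\<lambda>x. - g x"] by (simp add: baire_one_minus)

lemma baire_one_sum:
  "finite I \<Longrightarrow> (\<And>i. i \<in> I \<Longrightarrow> baire_one X (f i)) \<Longrightarrow> baire_one X (\<lambda>x. \<Sum>i\<in>I. f i x)"
  by (induction I rule: finite_induct) (auto intro: baire_one_add)

lemma baire_one_max: "baire_one X f \<Longrightarrow> baire_one X g \<Longrightarrow> baire_one X (\<lambda>x. max (f x) (g x))"
  unfolding baire_one_def
  by (elim exE, rule_tac x = "\<lambda>n x. max (F n x) (Fa n x)" in exI)
     (auto intro: tendsto_max continuous_map_real_max)

lemma baire_one_min: "baire_one X f \<Longrightarrow> baire_one X g \<Longrightarrow> baire_one X (\<lambda>x. min (f x) (g x))"
  unfolding baire_one_def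
  by (elim exE, rule_tac x = "\<lambda>n x. min (F n x) (Fa n x)" in exI)
     (auto intro: tendsto_min continuous_map_real_min)

text \<open>
  The approximants of a nowhere vanishing function may vanish, so they cannot be inverted directly;
  adding a small positive term to the denominator of \<open>F / F\<^sup>2\<close> repairs this.
\<close>

lemma baire_one_inverse:
  assumes f: "baire_one X f" and nz: "\<And>x. x \<in> topspace X \<Longrightarrow> f x \<noteq> 0"
  shows "baire_one X (\<lambda>x. inverse (f x))"
proof -
  obtain F where F: "\<And>n. continuous_map X euclideanreal (F n)"
      "\<And>x. x \<in> topspace X \<Longrightarrow> (\<lambda>n. F n x) \<longlonglongrightarrow> f x"
    using f by (auto simp: baire_one_def)
  define G where "G n x = F n x / (F n x ^ 2 + inverse (real (Suc n)))" for n x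
  have pos: "F n x ^ 2 + inverse (real (Suc n)) > 0" for n x
    by (rule add_nonneg_pos) auto
  have "continuous_map X euclideanreal (G n)" for n
    unfolding G_def using F(1) pos[of n]
    by (intro continuous_map_real_divide continuous_map_add continuous_map_real_pow)
      (auto simp: less_imp_neq[symmetric])
  moreover have "(\<lambda>n. G n x) \<longlonglongrightarrow> inverse (f x)" if x: "x \<in> topspace X" for x
  proof -
    have "(\<lambda>n. G n x) \<longlonglongrightarrow> f x / (f x ^ 2 + 0)"
      unfolding G_def using F(2)[OF x] nz[OF x]
      by (intro tendsto_intros LIMSEQ_inverse_real_of_nat) auto
    then show ?thesis
      using nz[OF x] by (simp add: power2_eq_square divide_simps)
  qed
  ultimately show ?thesis
    unfolding baire_one_def by blast
qed

text \<open>Truncation at the bound of the limit does not disturb convergence.\<close>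

lemma baire_one_bounded_approx:
  assumes f: "baire_one X f" and b: "\<And>x. x \<in> topspace X \<Longrightarrow> \<bar>f x\<bar> \<le> b" and "0 \<le> b"
  obtains F where "\<And>n. continuous_map X euclideanreal (F n)"
    "\<And>x. x \<in> topspace X \<Longrightarrow> (\<lambda>n. F n x) \<longlonglongrightarrow> f x"
    "\<And>n x. \<bar>F n x\<bar> \<le> b"
proof -
  obtain F where F: "\<And>n. continuous_map X euclideanreal (F n)"
      "\<And>x. x \<in> topspace X \<Longrightarrow> (\<lambda>n. F n x) \<longlonglongrightarrow> f x"
    using f by (auto simp: baire_one_def)
  define G where "G n x = max (- b) (min b (F n x))" for n x
  have "continuous_map X euclideanreal (G n)" for n
    unfolding G_def using F(1) by (intro continuous_map_real_max continuous_map_real_min) auto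
  moreover have "(\<lambda>n. G n x) \<longlonglongrightarrow> f x" if x: "x \<in> topspace X" for x
  proof -
    have "(\<lambda>n. G n x) \<longlonglongrightarrow> max (- b) (min b (f x))"
      unfolding G_def using F(2)[OF x] by (intro tendsto_max tendsto_min tendsto_const)
    moreover have "max (- b) (min b (f x)) = f x"
      using b[OF x] by (auto simp: abs_le_iff max_def min_def)
    ultimately show ?thesis
      by simp
  qed
  moreover have "\<bar>G n x\<bar> \<le> b" for n x
    using \<open>0 \<le> b\<close> by (auto simp: G_def)
  ultimately show ?thesis
    using that by blast
qed

text \<open>
  A rapidly convergent sequence of Baire one approximants turns the function into a series of Baire
  one functions dominated by a geometric series. The approximants of the terms can be truncated to
  the same bounds, so Tannery's theorem lets the diagonal partial sums of the approximants converge
  to the sum of the series.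
\<close>

lemma baire_one_uniform_limit:
  assumes approx: "\<And>e. 0 < e \<Longrightarrow> \<exists>h. baire_one X h \<and> (\<forall>x\<in>topspace X. \<bar>f x - h x\<bar> \<le> e)"
  shows "baire_one X f"
proof -
  define e :: "nat \<Rightarrow> real" where "e k = (1/2) ^ k" for k
  have e: "0 < e k" "e (Suc k) \<le> e k" for k
    by (auto simp: e_def)
  have "\<forall>k. \<exists>h. baire_one X h \<and> (\<forall>x\<in>topspace X. \<bar>f x - h x\<bar> \<le> e k)"
    using approx e(1) by blast
  then obtain h where h: "\<And>k. baire_one X (h k)"
      and fh: "\<And>k x. x \<in> topspace X \<Longrightarrow> \<bar>f x - h k x\<bar> \<le> e k"
    by metis
  define d where "d k x = h (Suc k) x - h k x" for k x
  have "\<exists>D. (\<forall>n. continuous_map X euclideanreal (D n)) \<and>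
      (\<forall>x\<in>topspace X. (\<lambda>n. D n x) \<longlonglongrightarrow> d k x) \<and> (\<forall>n x. \<bar>D n x\<bar> \<le> 2 * e k)" for k
  proof -
    have "\<bar>d k x\<bar> \<le> 2 * e k" if "x \<in> topspace X" for x
      using fh[OF that, of k] fh[OF that, of "Suc k"] e(2)[of k] by (simp add: d_def)
    moreover have "baire_one X (d k)"
      unfolding d_def by (intro baire_one_diff h)
    moreover have "0 \<le> 2 * e k"
      using e(1)[of k] by simp
    ultimately obtain D where "\<And>n. continuous_map X euclideanreal (D n)"
        "\<And>x. x \<in> topspace X \<Longrightarrow> (\<lambda>n. D n x) \<longlonglongrightarrow> d k x"
        "\<And>n x. \<bar>D n x\<bar> \<le> 2 * e k"
      using baire_one_bounded_approx[of X "d k" "2 * e k"] by blast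
    then show ?thesis
      by blast
  qed
  then obtain D where D: "\<And>k n. continuous_map X euclideanreal (D k n)"
      "\<And>k x. x \<in> topspace X \<Longrightarrow> (\<lambda>n. D k n x) \<longlonglongrightarrow> d k x"
      "\<And>k n x. \<bar>D k n x\<bar> \<le> 2 * e k"
    by metis
  obtain H where H: "\<And>n. continuous_map X euclideanreal (H n)"
      "\<And>x. x \<in> topspace X \<Longrightarrow> (\<lambda>n. H n x) \<longlonglongrightarrow> h 0 x"
    using h[of 0] by (auto simp: baire_one_def)
  have e_sum: "summable (\<lambda>k. 2 * e k)"
    unfolding e_def by (intro summable_mult summable_geometric) auto
  have "(\<lambda>n. H n x + (\<Sum>k<n. D k n x)) \<longlonglongrightarrow> f x" if x: "x \<in> topspace X" for x
  proof -
    have "(\<lambda>k. h k x) \<longlonglongrightarrow> f x"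
    proof (rule LIM_zero_cancel, rule Lim_null_comparison)
      show "\<forall>\<^sub>F k in sequentially. norm (h k x - f x) \<le> e k"
        using fh[OF x] by (simp add: abs_minus_commute)
      show "e \<longlonglongrightarrow> 0"
        unfolding e_def by (intro LIMSEQ_power_zero) auto
    qed
    then have d: "(\<lambda>k. d k x) sums (f x - h 0 x)"
      unfolding d_def by (rule telescope_sums)
    \<comment> \<open>Padding the diagonal partial sums with zeros makes them full series.\<close>
    define a where "a k n = (if k < n then D k n x else 0)" for k n
    have "(\<lambda>n. suminf (\<lambda>k. a k n)) \<longlonglongrightarrow> (\<Sum>k. d k x)"
    proof (intro tannerys_theorem[THEN conjunct2, THEN conjunct2])
      show "(\<lambda>n. a k n) \<longlonglongrightarrow> d k x" for k
      proof (rule Lim_transform_eventually[OF D(2)[OF x]])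
        show "\<forall>\<^sub>F n in sequentially. D k n x = a k n"
          using eventually_gt_at_top[of k] by eventually_elim (simp add: a_def)
      qed
      show "\<forall>\<^sub>F (k, n) in sequentially \<times>\<^sub>F sequentially. norm (a k n) \<le> 2 * e k"
        using D(3) e(1) by (auto simp: a_def less_imp_le intro!: always_eventually)
    qed (use e_sum in auto)
    moreover have "suminf (\<lambda>k. a k n) = (\<Sum>k<n. D k n x)" for n
      by (subst suminf_finite[of "{..<n}"]) (auto simp: a_def)
    ultimately have "(\<lambda>n. \<Sum>k<n. D k n x) \<longlonglongrightarrow> f x - h 0 x"
      using sums_unique[OF d] by simp
    from tendsto_add[OF H(2)[OF x] this] show ?thesis
      by simp
  qed
  moreover have "continuous_map X euclideanreal (\<lambda>x. H n x + (\<Sum>k<n. D k n x))" for n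
    by (intro continuous_map_add continuous_map_sum H D) auto
  ultimately show ?thesis
    unfolding baire_one_def by (intro exI[of _ "\<lambda>n x. H n x + (\<Sum>k<n. D k n x)"]) blast
qed

text \<open>
  Functions that separate consecutive levels \<open>t\<^sub>i\<close> and \<open>t\<^sub>i + e\<close>, truncated to values in
  \<open>[0, 1]\<close>, add up to a staircase that follows the function within one step of height \<open>e\<close>.
\<close>

lemma baire_one_if_levels_separated:
  assumes bdd: "bounded (f ` topspace X)"
    and sep: "\<And>a b :: real. a < b \<Longrightarrow> \<exists>g. baire_one X g \<and>
      (\<forall>x\<in>topspace X. (f x \<le> a \<longrightarrow> g x = 0) \<and> (b \<le> f x \<longrightarrow> g x = 1))"
  shows "baire_one X f"
proof (rule baire_one_uniform_limit)
  fix e :: real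
  assume "0 < e"
  obtain K where K: "\<And>x. x \<in> topspace X \<Longrightarrow> \<bar>f x\<bar> \<le> K"
    using bdd by (auto simp: bounded_iff)
  define t where "t i = - K + real i * e" for i
  have t_Suc: "t (Suc i) = t i + e" for i
    by (simp add: t_def algebra_simps)
  have "\<forall>i. \<exists>g. baire_one X g \<and>
      (\<forall>x\<in>topspace X. (f x \<le> t i \<longrightarrow> g x = 0) \<and> (t (Suc i) \<le> f x \<longrightarrow> g x = 1))"
    using sep \<open>0 < e\<close> t_Suc by simp
  then obtain g where g: "\<And>i. baire_one X (g i)"
      "\<And>i x. x \<in> topspace X \<Longrightarrow> f x \<le> t i \<Longrightarrow> g i x = 0"
      "\<And>i x. x \<in> topspace X \<Longrightarrow> t (Suc i) \<le> f x \<Longrightarrow> g i x = 1"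
    by metis
  define c where "c i x = max 0 (min 1 (g i x))" for i x
  have c: "0 \<le> c i x" "c i x \<le> 1" for i x
    by (auto simp: c_def)
  define h where "h n x = - K + (\<Sum>i<n. e * c i x)" for n x
  \<comment> \<open>Exactness of the partial sums below the value of \<open>f\<close> keeps the errors of the steps from adding up.\<close>
  have stair: "(t n \<le> f x \<longrightarrow> h n x = t n) \<and> \<bar>h n x - min (f x) (t n)\<bar> \<le> e"
    if x: "x \<in> topspace X" for n x
  proof (induction n)
    case 0
    show ?case
      using K[OF x] \<open>0 < e\<close> by (auto simp: h_def t_def min_def abs_le_iff)
  next
    case (Suc n)
    have h: "h (Suc n) x = h n x + e * c n x"
      by (simp add: h_def)
    consider "f x \<le> t n" | "t n < f x" "f x < t (Suc n)" | "t (Suc n) \<le> f x"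
      by linarith
    then show ?case
    proof cases
      case 1
      then have "c n x = 0"
        using g(2)[OF x] by (simp add: c_def)
      then show ?thesis
        using Suc 1 \<open>0 < e\<close> by (auto simp: h t_Suc min_def)
    next
      case 2
      then have "h n x = t n"
        using Suc by simp
      moreover have "0 \<le> e * c n x" "e * c n x \<le> e"
        using c \<open>0 < e\<close> by (auto simp: mult_left_le)
      moreover have "min (f x) (t (Suc n)) = f x"
        using 2(2) by simp
      ultimately show ?thesis
        using 2 unfolding h t_Suc abs_le_iff by linarith
    next
      case 3
      then have "c n x = 1" "h n x = t n"
        using g(3)[OF x] Suc t_Suc[of n] \<open>0 < e\<close> by (auto simp: c_def)
      then show ?thesis
        using 3 \<open>0 < e\<close> by (simp add: h t_Suc)
    qed
  qed
  obtain N :: nat where "2 * K / e \<le> real N"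
    using real_arch_simple by blast
  then have N: "K \<le> t N"
    using \<open>0 < e\<close> by (simp add: t_def field_simps)
  have "\<bar>f x - h N x\<bar> \<le> e" if x: "x \<in> topspace X" for x
    using stair[OF x, of N] K[OF x] N by (auto simp: min_def abs_le_iff split: if_splits)
  moreover have "baire_one X (h N)"
    unfolding h_def c_def
    by (intro baire_one_add baire_one_sum baire_one_mult baire_one_max baire_one_min
        baire_one_const g) auto
  ultimately show "\<exists>h. baire_one X h \<and> (\<forall>x\<in>topspace X. \<bar>f x - h x\<bar> \<le> e)"
    by blast
qed

section \<open>Maximal ideals of commutative rings\<close>

context cring
begin

lemma idealI_mult:
  assumes sub: "I \<subseteq> carrier R" and zero: "\<zero> \<in> I"
    and add: "\<And>x y. x \<in> I \<Longrightarrow> y \<in> I \<Longrightarrow> x \<oplus> y \<in> I"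
    and mult: "\<And>x y. x \<in> I \<Longrightarrow> y \<in> carrier R \<Longrightarrow> y \<otimes> x \<in> I"
  shows "ideal I R"
proof (rule idealI[OF ring_axioms])
  have "\<ominus> x \<in> I" if "x \<in> I" for x
    using mult[OF that, of "\<ominus> \<one>"] sub that l_minus[of \<one> x] by auto
  then show "subgroup I (add_monoid R)"
    using sub zero add by (intro group.subgroupI a_group) (auto simp: a_inv_def)
  show "y \<otimes> x \<in> I" "x \<otimes> y \<in> I" if "x \<in> I" "y \<in> carrier R" for x y
    using mult[OF that] m_comm[of x y] that sub by auto
qed

lemma maximalideal_above:
  assumes "ideal I R" "\<one> \<notin> I"
  obtains M where "maximalideal M R" "I \<subseteq> M"
proof -
  let ?A = "{J. ideal J R \<and> I \<subseteq> J \<and> \<one> \<notin> J}"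
  have "\<exists>M\<in>?A. \<forall>J\<in>?A. M \<subseteq> J \<longrightarrow> J = M"
  proof (rule subset_Zorn_nonempty)
    show "?A \<noteq> {}"
      using assms by blast
    fix C assume C: "C \<noteq> {}" "subset.chain ?A C"
    then have "subset.chain {J. ideal J R} C"
      unfolding pred_on.chain_def by blast
    then have "ideal (\<Union>C) R"
      using chain_Union_is_ideal[of C] C(1) by simp
    moreover have "C \<subseteq> ?A"
      using C(2) by (simp add: pred_on.chain_def)
    ultimately show "\<Union>C \<in> ?A"
      using C(1) by blast
  qed
  then obtain M where "M \<in> ?A" and max: "\<forall>J\<in>?A. M \<subseteq> J \<longrightarrow> J = M" ..
  then have M: "ideal M R" "I \<subseteq> M" "\<one> \<notin> M"
    by auto
  have "maximalideal M R"
  proof (rule maximalidealI[OF M(1)])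
    show "carrier R \<noteq> M"
      using M(3) by auto
    fix J assume J: "ideal J R" "M \<subseteq> J" "J \<subseteq> carrier R"
    show "J = M \<or> J = carrier R"
    proof (cases "\<one> \<in> J")
      case True
      then show ?thesis
        using ideal.one_imp_carrier[OF J(1)] by simp
    next
      case False
      then have "J \<in> ?A"
        using J M(2) by auto
      then show ?thesis
        using max J(2) by auto
    qed
  qed
  then show ?thesis
    using that M(2) by blast
qed

text \<open>
  The ideals generated by the functions defining two disjoint hulls lie in no common maximal ideal,
  so they add up to the whole ring.
\<close>

lemma closedin_maximal_ideal_space_separation:
  assumes C: "closedin (maximal_ideal_space R) C" and D: "closedin (maximal_ideal_space R) D"
    and disj: "C \<inter> D = {}"
  obtains g h where "g \<in> carrier R" "h \<in> carrier R" "g \<oplus> h = \<one>"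
    "\<And>M. M \<in> C \<Longrightarrow> g \<in> M" "\<And>M. M \<in> D \<Longrightarrow> h \<in> M"
proof -
  obtain F where F: "F \<subseteq> carrier R"
      "C = {M. maximalideal M R} \<inter> (\<Inter>f\<in>F. {M. maximalideal M R \<and> f \<in> M})"
    using C by (auto simp: closedin_maximal_ideal_space)
  obtain G where G: "G \<subseteq> carrier R"
      "D = {M. maximalideal M R} \<inter> (\<Inter>f\<in>G. {M. maximalideal M R \<and> f \<in> M})"
    using D by (auto simp: closedin_maximal_ideal_space)
  have FG: "ideal (Idl F) R" "ideal (Idl G) R"
    using F(1) G(1) by (auto intro: genideal_ideal)
  let ?J = "set_add R (Idl F) (Idl G)"
  have "\<one> \<in> ?J"
  proof (rule ccontr)
    assume "\<one> \<notin> ?J"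
    then obtain M where M: "maximalideal M R" "?J \<subseteq> M"
      using maximalideal_above add_ideals[OF FG] by blast
    have "F \<union> G \<subseteq> ?J"
    proof -
      have "Idl F \<union> Idl G \<subseteq> carrier R"
        using ideal.Icarr[OF FG(1)] ideal.Icarr[OF FG(2)] by blast
      then have "Idl F \<union> Idl G \<subseteq> ?J"
        using genideal_self[of "Idl F \<union> Idl G"] union_genideal[OF FG] by simp
      then show ?thesis
        using genideal_self[OF F(1)] genideal_self[OF G(1)] by blast
    qed
    then have "F \<subseteq> M" "G \<subseteq> M"
      using M(2) by auto
    then have "M \<in> C" "M \<in> D"
      using M(1) F(2) G(2) by auto
    then show False
      using disj by blast
  qed
  then obtain g h where gh: "g \<in> Idl F" "h \<in> Idl G" "\<one> = g \<oplus> h"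
    by (auto simp: set_add_def')
  show ?thesis
  proof (rule that)
    show "g \<in> carrier R" "h \<in> carrier R" "g \<oplus> h = \<one>"
      using gh ideal.Icarr[OF FG(1)] ideal.Icarr[OF FG(2)] by auto
    show "g \<in> M" if "M \<in> C" for M
      using genideal_minimal[of M F] that F(2) gh(1) maximalideal.axioms(1)[of M] by auto
    show "h \<in> M" if "M \<in> D" for M
      using genideal_minimal[of M G] that G(2) gh(2) maximalideal.axioms(1)[of M] by auto
  qed
qed

end

section \<open>The zero-set filter of a maximal ideal\<close>

lemma B1_ring_simps [simp]:
  "f \<in> carrier (B1_ring X) \<longleftrightarrow> f \<in> extensional (topspace X) \<and> baire_one X f"
  "f \<otimes>\<^bsub>B1_ring X\<^esub> g = (\<lambda>x\<in>topspace X. f x * g x)"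
  "f \<oplus>\<^bsub>B1_ring X\<^esub> g = (\<lambda>x\<in>topspace X. f x + g x)"
  "\<one>\<^bsub>B1_ring X\<^esub> = (\<lambda>x\<in>topspace X. 1)"
  "\<zero>\<^bsub>B1_ring X\<^esub> = (\<lambda>x\<in>topspace X. 0)"
  by (auto simp: B1_ring_def fun_ring_def)

text \<open>
  Zero sets of members of a maximal ideal \<open>M\<close> behave like an ultrafilter among the zero sets of Baire
  one functions. The limit of a bounded function along the filter that they generate is the real
  number infinitely close to the residue of the function in the ordered field \<open>B\<^sub>1(X) / M\<close>; filter limits
  give it without a construction of that field.
\<close>

definition zero_filter :: "'a topology \<Rightarrow> ('a \<Rightarrow> real) set \<Rightarrow> 'a filter"
  where "zero_filter X M = (INF g\<in>M. principal {x \<in> topspace X. g x = 0})"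

context
  fixes X :: "'a topology" and M
  assumes M: "maximalideal M (B1_ring X)"
begin

interpretation maximalideal M "B1_ring X"
  by (rule M)

interpretation primeideal M "B1_ring X"
  using cring_B1_ring cring.maximalideal_prime M by blast

lemma maximalideal_mem_baire_one: "g \<in> M \<Longrightarrow> baire_one X g"
  using Icarr[of g] by simp

lemma maximalideal_zero_mem: "(\<lambda>x\<in>topspace X. 0) \<in> M"
  using additive_subgroup.zero_closed[OF is_additive_subgroup] by simp

lemma maximalideal_add_mem: "f \<in> M \<Longrightarrow> g \<in> M \<Longrightarrow> (\<lambda>x\<in>topspace X. f x + g x) \<in> M"
  using additive_subgroup.a_closed[OF is_additive_subgroup, of f g] by simp

lemma maximalideal_mult_mem:
  assumes "g \<in> M" "baire_one X h"
  shows "(\<lambda>x\<in>topspace X. h x * g x) \<in> M"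
proof -
  have "(\<lambda>x\<in>topspace X. restrict h (topspace X) x * g x) \<in> M"
    using I_l_closed[OF assms(1), of "restrict h (topspace X)"] assms(2) by simp
  moreover have "(\<lambda>x\<in>topspace X. restrict h (topspace X) x * g x) = (\<lambda>x\<in>topspace X. h x * g x)"
    by (rule restrict_ext) simp
  ultimately show ?thesis
    by simp
qed

lemma maximalideal_one_notin: "(\<lambda>x\<in>topspace X. 1) \<notin> M"
  using one_imp_carrier I_notcarr by auto

text \<open>A nowhere vanishing Baire one function is a unit.\<close>

lemma maximalideal_mem_has_zero:
  assumes "g \<in> M"
  shows "\<exists>x\<in>topspace X. g x = 0"
proof (rule ccontr)
  assume nz: "\<not> (\<exists>x\<in>topspace X. g x = 0)"
  then have "(\<lambda>x\<in>topspace X. inverse (g x) * g x) \<in> M"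
    using assms by (intro maximalideal_mult_mem baire_one_inverse maximalideal_mem_baire_one) auto
  moreover have "(\<lambda>x\<in>topspace X. inverse (g x) * g x) = (\<lambda>x\<in>topspace X. 1)"
    using nz by (intro restrict_ext) auto
  ultimately show False
    using maximalideal_one_notin by simp
qed

text \<open>The zero set of \<open>g\<^sup>2 + h\<^sup>2\<close> is the intersection of the zero sets of \<open>g\<close> and \<open>h\<close>.\<close>

lemma eventually_zero_filter:
  "eventually P (zero_filter X M) \<longleftrightarrow> (\<exists>g\<in>M. \<forall>x\<in>topspace X. g x = 0 \<longrightarrow> P x)"
proof -
  have "\<exists>k\<in>M. principal {x \<in> topspace X. k x = 0} \<le>
      inf (principal {x \<in> topspace X. g x = 0}) (principal {x \<in> topspace X. h x = 0})"
    if "g \<in> M" "h \<in> M" for g h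
  proof (rule bexI)
    let ?k = "\<lambda>x\<in>topspace X. (\<lambda>x\<in>topspace X. g x * g x) x + (\<lambda>x\<in>topspace X. h x * h x) x"
    show "?k \<in> M"
      using that by (intro maximalideal_add_mem maximalideal_mult_mem maximalideal_mem_baire_one)
    show "principal {x \<in> topspace X. ?k x = 0} \<le>
        inf (principal {x \<in> topspace X. g x = 0}) (principal {x \<in> topspace X. h x = 0})"
      by (auto simp: sum_squares_eq_zero_iff)
  qed
  then have "eventually P (zero_filter X M) \<longleftrightarrow>
      (\<exists>g\<in>M. eventually P (principal {x \<in> topspace X. g x = 0}))"
    unfolding zero_filter_def using maximalideal_zero_mem by (intro eventually_INF_base) auto
  then show ?thesis
    by (auto simp: eventually_principal)
qed

lemma eventually_zero: "g \<in> M \<Longrightarrow> eventually (\<lambda>x. g x = 0) (zero_filter X M)"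
  by (auto simp: eventually_zero_filter)

lemma eventually_in_topspace: "eventually (\<lambda>x. x \<in> topspace X) (zero_filter X M)"
  using maximalideal_zero_mem by (auto simp: eventually_zero_filter)

lemma zero_filter_neq_bot: "zero_filter X M \<noteq> bot"
  using maximalideal_mem_has_zero by (fastforce simp: trivial_limit_def eventually_zero_filter)

text \<open>
  The positive parts of \<open>f - c\<close> and of \<open>c - f\<close> have product zero, so one of them lies in the prime
  ideal \<open>M\<close>.
\<close>

lemma positive_part_mem_cases:
  assumes f: "baire_one X f"
  shows "(\<lambda>x\<in>topspace X. max 0 (f x - c)) \<in> M \<or> (\<lambda>x\<in>topspace X. max 0 (c - f x)) \<in> M"
proof (rule I_prime)
  show "(\<lambda>x\<in>topspace X. max 0 (f x - c)) \<in> carrier (B1_ring X)"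
    "(\<lambda>x\<in>topspace X. max 0 (c - f x)) \<in> carrier (B1_ring X)"
    using f by (auto intro!: baire_one_max baire_one_diff)
  have "(\<lambda>x\<in>topspace X. (\<lambda>x\<in>topspace X. max 0 (f x - c)) x * (\<lambda>x\<in>topspace X. max 0 (c - f x)) x)
      = (\<lambda>x\<in>topspace X. 0)"
    by (rule restrict_ext) (auto simp: max_def)
  then show "(\<lambda>x\<in>topspace X. max 0 (f x - c)) \<otimes>\<^bsub>B1_ring X\<^esub> (\<lambda>x\<in>topspace X. max 0 (c - f x)) \<in> M"
    using maximalideal_zero_mem by simp
qed

lemma positive_part_mem_imp_eventually_le:
  assumes "(\<lambda>x\<in>topspace X. max 0 (f x - g x)) \<in> M"
  shows "eventually (\<lambda>x. f x \<le> g x) (zero_filter X M)"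
  using eventually_zero[OF assms] eventually_in_topspace
  by eventually_elim (auto simp: max_def split: if_splits)

lemma eventually_le_or_ge:
  assumes "baire_one X f"
  shows "eventually (\<lambda>x. f x \<le> c) (zero_filter X M) \<or> eventually (\<lambda>x. c \<le> f x) (zero_filter X M)"
  using positive_part_mem_cases[OF assms, of c]
    positive_part_mem_imp_eventually_le[of f "\<lambda>_. c"] positive_part_mem_imp_eventually_le[of "\<lambda>_. c" f]
  by auto

text \<open>
  Since the filter decides between \<open>f \<le> c\<close> and \<open>f \<ge> c\<close> for every \<open>c\<close>, a bounded \<open>f\<close> converges to the
  supremum of its eventual lower bounds.
\<close>

lemma bounded_baire_one_convergent:
  assumes f: "baire_one X f" and bdd: "bounded (f ` topspace X)"
  shows "\<exists>r. (f \<longlongrightarrow> r) (zero_filter X M)"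
proof
  let ?F = "zero_filter X M"
  define L where "L = {b. eventually (\<lambda>x. b \<le> f x) ?F}"
  obtain K where K: "\<And>x. x \<in> topspace X \<Longrightarrow> \<bar>f x\<bar> \<le> K"
    using bdd by (auto simp: bounded_iff)
  have "- K \<in> L"
    using eventually_in_topspace unfolding L_def
    by (auto elim!: eventually_mono dest!: K)
  then have "L \<noteq> {}"
    by blast
  have "b \<le> K" if "b \<in> L" for b
  proof -
    have "eventually (\<lambda>x. b \<le> K) ?F"
      using that[unfolded L_def mem_Collect_eq] eventually_in_topspace by eventually_elim (use K in force)
    then show ?thesis
      using zero_filter_neq_bot by (simp add: eventually_const_iff)
  qed
  then have bdd_L: "bdd_above L"
    by (rule bdd_aboveI)
  show "(f \<longlongrightarrow> Sup L) ?F"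
  proof (rule order_tendstoI)
    fix a assume "a < Sup L"
    then obtain b where "b \<in> L" "a < b"
      using less_cSup_iff[OF \<open>L \<noteq> {}\<close> bdd_L] by blast
    then show "eventually (\<lambda>x. a < f x) ?F"
      by (auto simp: L_def elim!: eventually_mono)
  next
    fix a assume "Sup L < a"
    then obtain c where c: "Sup L < c" "c < a"
      using dense by blast
    then have "c \<notin> L"
      using cSup_upper[OF _ bdd_L] by force
    then have "eventually (\<lambda>x. f x \<le> c) ?F"
      using eventually_le_or_ge[OF f, of c] by (auto simp: L_def)
    then show "eventually (\<lambda>x. f x < a) ?F"
      by eventually_elim (use c in simp)
  qed
qed

end

text \<open>
  The restriction makes the result an element of \<^const>\<open>C_ring\<close>, whose members are extensional.
\<close>

definition ideal_limit :: "'a topology \<Rightarrow> ('a \<Rightarrow> real) \<Rightarrow> ('a \<Rightarrow> real) set \<Rightarrow> real"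
  where "ideal_limit X f = (\<lambda>M\<in>{M. maximalideal M (B1_ring X)}. Lim (zero_filter X M) f)"

lemma tendsto_ideal_limit:
  assumes "baire_one X f" "bounded (f ` topspace X)" "maximalideal M (B1_ring X)"
  shows "(f \<longlongrightarrow> ideal_limit X f M) (zero_filter X M)"
  using bounded_baire_one_convergent[OF assms(3,1,2)] tendsto_Lim[OF zero_filter_neq_bot[OF assms(3)]]
    assms(3) by (auto simp: ideal_limit_def)

lemma ideal_limit_eqI:
  assumes "maximalideal M (B1_ring X)" "(f \<longlongrightarrow> r) (zero_filter X M)"
  shows "ideal_limit X f M = r"
  using tendsto_Lim[OF zero_filter_neq_bot[OF assms(1)] assms(2)] assms(1)
  by (simp add: ideal_limit_def)

lemma ideal_limit_minus:
  assumes f: "baire_one X f" "bounded (f ` topspace X)" and M: "maximalideal M (B1_ring X)"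
  shows "ideal_limit X (\<lambda>x. - f x) M = - ideal_limit X f M"
  by (intro ideal_limit_eqI[OF M] tendsto_minus tendsto_ideal_limit f M)

text \<open>
  Membership of the positive part of \<open>f - c\<close> in \<open>M\<close> decides on which side of \<open>c\<close> the limit lies, so
  basic open sets of the hull-kernel topology witness that the superlevel sets are open.
\<close>

lemma openin_ideal_limit_greater:
  assumes f: "baire_one X f" "bounded (f ` topspace X)"
  shows "openin (maximal_ideal_space (B1_ring X)) {M. maximalideal M (B1_ring X) \<and> a < ideal_limit X f M}"
    (is "openin ?T ?U")
proof (subst openin_subopen, intro ballI)
  interpret cring "B1_ring X"
    by (rule cring_B1_ring)
  fix M assume "M \<in> ?U"
  then have M: "maximalideal M (B1_ring X)" and "a < ideal_limit X f M"
    by auto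
  then obtain c where c: "a < c" "c < ideal_limit X f M"
    using dense by blast
  define g where "g = (\<lambda>x\<in>topspace X. max 0 (f x - c))"
  let ?V = "{N. maximalideal N (B1_ring X) \<and> g \<notin> N}"
  have "g \<in> carrier (B1_ring X)"
    unfolding g_def using f(1) by (auto intro!: baire_one_max baire_one_diff)
  then have "openin ?T ?V"
    unfolding openin_maximal_ideal_space by (intro arbitrary_union_of_inc) blast
  moreover have "g \<notin> M"
  proof
    assume "g \<in> M"
    then have "eventually (\<lambda>x. f x \<le> c) (zero_filter X M)"
      using positive_part_mem_imp_eventually_le[OF M, of f "\<lambda>_. c"] by (simp add: g_def)
    then have "ideal_limit X f M \<le> c"
      using tendsto_upperbound[OF tendsto_ideal_limit[OF f M]] zero_filter_neq_bot[OF M] by blast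
    then show False
      using c by simp
  qed
  moreover have "?V \<subseteq> ?U"
  proof
    fix N assume "N \<in> ?V"
    then have N: "maximalideal N (B1_ring X)" "g \<notin> N"
      by auto
    then have "eventually (\<lambda>x. c \<le> f x) (zero_filter X N)"
      using positive_part_mem_cases[OF N(1) f(1), of c]
        positive_part_mem_imp_eventually_le[OF N(1), of "\<lambda>_. c" f] by (auto simp: g_def)
    then have "c \<le> ideal_limit X f N"
      using tendsto_lowerbound[OF tendsto_ideal_limit[OF f N(1)]] zero_filter_neq_bot[OF N(1)] by blast
    then show "N \<in> ?U"
      using N c by simp
  qed
  ultimately show "\<exists>T. openin ?T T \<and> M \<in> T \<and> T \<subseteq> ?U"
    using M by (intro exI[of _ ?V]) auto
qed

lemma continuous_map_ideal_limit:
  assumes f: "baire_one X f" "bounded (f ` topspace X)"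
  shows "continuous_map (maximal_ideal_space (B1_ring X)) euclideanreal (ideal_limit X f)"
proof -
  have "{M. maximalideal M (B1_ring X) \<and> ideal_limit X f M < a} =
      {M. maximalideal M (B1_ring X) \<and> - a < ideal_limit X (\<lambda>x. - f x) M}" for a
    using ideal_limit_minus[OF f] by auto
  moreover have "bounded ((\<lambda>x. - f x) ` topspace X)"
    using f(2) by (simp add: bounded_iff)
  ultimately show ?thesis
    using openin_ideal_limit_greater[OF f] openin_ideal_limit_greater[of X "\<lambda>x. - f x"] f(1)
    by (simp add: continuous_map_upper_lower_semicontinuous_lt baire_one_minus
        cring.topspace_maximal_ideal_space[OF cring_B1_ring])
qed

section \<open>Continuous functions on the maximal ideal space\<close>

definition point_ideal :: "'a topology \<Rightarrow> 'a \<Rightarrow> ('a \<Rightarrow> real) set"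
  where "point_ideal X x = {f \<in> carrier (B1_ring X). f x = 0}"

text \<open>
  A function \<open>h\<close> with \<open>h x \<noteq> 0\<close> together with the functions vanishing at \<open>x\<close> generates the unit, since
  \<open>1 - h / h x\<close> vanishes at \<open>x\<close>.
\<close>

lemma maximalideal_point_ideal:
  assumes x: "x \<in> topspace X"
  shows "maximalideal (point_ideal X x) (B1_ring X)"
proof (rule maximalidealI)
  interpret cring "B1_ring X"
    by (rule cring_B1_ring)
  show "ideal (point_ideal X x) (B1_ring X)"
    using x by (intro idealI_mult)
      (auto simp: point_ideal_def intro: baire_one_add baire_one_mult)
  show "carrier (B1_ring X) \<noteq> point_ideal X x"
  proof
    assume "carrier (B1_ring X) = point_ideal X x"
    then have "\<one>\<^bsub>B1_ring X\<^esub> \<in> point_ideal X x"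
      using one_closed by blast
    then show False
      using x by (simp add: point_ideal_def)
  qed
  fix J assume J: "ideal J (B1_ring X)" "point_ideal X x \<subseteq> J" "J \<subseteq> carrier (B1_ring X)"
  interpret J: ideal J "B1_ring X"
    by (rule J)
  show "J = point_ideal X x \<or> J = carrier (B1_ring X)"
  proof (cases "J \<subseteq> point_ideal X x")
    case False
    then obtain h where h: "h \<in> J" "h x \<noteq> 0"
      using J(3) by (auto simp: point_ideal_def)
    define u where "u = (\<lambda>y\<in>topspace X. inverse (h x) * h y)"
    define v where "v = (\<lambda>y\<in>topspace X. 1 - u y)"
    have "u = (\<lambda>y\<in>topspace X. inverse (h x)) \<otimes>\<^bsub>B1_ring X\<^esub> h"
      by (auto simp: u_def)
    then have u: "u \<in> J"
      using J.I_l_closed[OF h(1), of "\<lambda>y\<in>topspace X. inverse (h x)"] by simp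
    then have "baire_one X v"
      using J(3) unfolding v_def by (auto intro!: baire_one_diff)
    moreover have "v x = 0" "v \<in> extensional (topspace X)"
      using x h(2) by (auto simp: v_def u_def)
    ultimately have "v \<in> point_ideal X x"
      by (simp add: point_ideal_def)
    then have "u \<oplus>\<^bsub>B1_ring X\<^esub> v \<in> J"
      using J(2) u by blast
    moreover have "u \<oplus>\<^bsub>B1_ring X\<^esub> v = \<one>\<^bsub>B1_ring X\<^esub>"
      by (auto simp: v_def)
    ultimately show ?thesis
      using J.one_imp_carrier by simp
  qed (use J in blast)
qed

lemma ideal_limit_point_ideal:
  assumes x: "x \<in> topspace X" and f: "baire_one X f"
  shows "ideal_limit X f (point_ideal X x) = f x"
proof (rule ideal_limit_eqI[OF maximalideal_point_ideal[OF x]])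
  have "(\<lambda>y\<in>topspace X. f y - f x) \<in> point_ideal X x"
    using x f by (auto simp: point_ideal_def intro!: baire_one_diff)
  then have "eventually (\<lambda>y. f y = f x) (zero_filter X (point_ideal X x))"
    by (auto simp: eventually_zero_filter[OF maximalideal_point_ideal[OF x]]
        intro!: bexI[of _ "\<lambda>y\<in>topspace X. f y - f x"])
  then show "(f \<longlongrightarrow> f x) (zero_filter X (point_ideal X x))"
    by (rule tendsto_eventually)
qed

context
  fixes X :: "'a topology" and \<phi> :: "('a \<Rightarrow> real) set \<Rightarrow> real"
  assumes \<phi>: "continuous_map (maximal_ideal_space (B1_ring X)) euclideanreal \<phi>"
begin

text \<open>
  The sets \<open>\<phi> \<le> a\<close> and \<open>\<phi> \<ge> b\<close> are disjoint hulls. Evaluated at the point ideals, the resulting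
  decomposition of the unit separates the corresponding level sets on \<open>X\<close>.
\<close>

lemma separate_levels:
  assumes "a < b"
  obtains g h where "baire_one X g" "baire_one X h" "h \<in> extensional (topspace X)"
    "\<And>x. x \<in> topspace X \<Longrightarrow> g x + h x = 1"
    "\<And>M. maximalideal M (B1_ring X) \<Longrightarrow> \<phi> M \<le> a \<Longrightarrow> g \<in> M"
    "\<And>M. maximalideal M (B1_ring X) \<Longrightarrow> b \<le> \<phi> M \<Longrightarrow> h \<in> M"
    "\<And>x. x \<in> topspace X \<Longrightarrow> \<phi> (point_ideal X x) \<le> a \<Longrightarrow> g x = 0"
    "\<And>x. x \<in> topspace X \<Longrightarrow> b \<le> \<phi> (point_ideal X x) \<Longrightarrow> h x = 0"
proof -
  interpret cring "B1_ring X"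
    by (rule cring_B1_ring)
  let ?T = "maximal_ideal_space (B1_ring X)"
  have "closedin ?T {M \<in> topspace ?T. \<phi> M \<in> {..a}}" "closedin ?T {M \<in> topspace ?T. \<phi> M \<in> {b..}}"
    by (intro closedin_continuous_map_preimage[OF \<phi>]; simp)+
  moreover have "{M \<in> topspace ?T. \<phi> M \<in> {..a}} \<inter> {M \<in> topspace ?T. \<phi> M \<in> {b..}} = {}"
    using assms by auto
  ultimately obtain g h where gh: "g \<in> carrier (B1_ring X)" "h \<in> carrier (B1_ring X)"
    "g \<oplus>\<^bsub>B1_ring X\<^esub> h = \<one>\<^bsub>B1_ring X\<^esub>"
    and g: "\<And>M. M \<in> {M \<in> topspace ?T. \<phi> M \<in> {..a}} \<Longrightarrow> g \<in> M"
    and h: "\<And>M. M \<in> {M \<in> topspace ?T. \<phi> M \<in> {b..}} \<Longrightarrow> h \<in> M"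
    using closedin_maximal_ideal_space_separation by blast
  have "g x + h x = 1" if "x \<in> topspace X" for x
    using fun_cong[OF gh(3), of x] that by simp
  moreover have g_mem: "g \<in> M" if "maximalideal M (B1_ring X)" "\<phi> M \<le> a" for M
    using g that by (simp add: topspace_maximal_ideal_space)
  moreover have h_mem: "h \<in> M" if "maximalideal M (B1_ring X)" "b \<le> \<phi> M" for M
    using h that by (simp add: topspace_maximal_ideal_space)
  moreover have "g x = 0" if "x \<in> topspace X" "\<phi> (point_ideal X x) \<le> a" for x
    using g_mem[OF maximalideal_point_ideal] that by (simp add: point_ideal_def)
  moreover have "h x = 0" if "x \<in> topspace X" "b \<le> \<phi> (point_ideal X x)" for x
    using h_mem[OF maximalideal_point_ideal] that by (simp add: point_ideal_def)
  ultimately show ?thesis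
    using that[of g h] gh(1,2) by simp
qed

text \<open>
  When points are identified with their point ideals, the zero-set filter of \<open>M\<close> converges to \<open>M\<close>:
  separating a level on either side of \<open>\<phi> M\<close> yields a member of \<open>M\<close> all of whose zeros lie on the
  side of \<open>\<phi> M\<close>. Hence \<open>\<phi>\<close> is determined by its values at the point ideals.
\<close>

lemma tendsto_at_maximalideal:
  assumes M: "maximalideal M (B1_ring X)"
  shows "((\<lambda>x. \<phi> (point_ideal X x)) \<longlongrightarrow> \<phi> M) (zero_filter X M)"
proof (rule order_tendstoI)
  fix a assume "a < \<phi> M"
  then obtain b where "a < b" "b \<le> \<phi> M"
    using dense less_imp_le by blast
  then obtain g h where gh: "h \<in> M"
      "\<And>x. x \<in> topspace X \<Longrightarrow> g x + h x = 1"
      "\<And>x. x \<in> topspace X \<Longrightarrow> \<phi> (point_ideal X x) \<le> a \<Longrightarrow> g x = 0"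
    using separate_levels[of a b] M by metis
  show "eventually (\<lambda>x. a < \<phi> (point_ideal X x)) (zero_filter X M)"
    using eventually_zero[OF M gh(1)] eventually_in_topspace[OF M]
    by eventually_elim (use gh in force)
next
  fix a assume "\<phi> M < a"
  then obtain b where "\<phi> M \<le> b" "b < a"
    using dense less_imp_le by blast
  then obtain g h where gh: "g \<in> M"
      "\<And>x. x \<in> topspace X \<Longrightarrow> g x + h x = 1"
      "\<And>x. x \<in> topspace X \<Longrightarrow> a \<le> \<phi> (point_ideal X x) \<Longrightarrow> h x = 0"
    using separate_levels[of b a] M by metis
  show "eventually (\<lambda>x. \<phi> (point_ideal X x) < a) (zero_filter X M)"
    using eventually_zero[OF M gh(1)] eventually_in_topspace[OF M]
    by eventually_elim (use gh in force)
qed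

text \<open>
  If the values were unbounded, the functions vanishing wherever the values are large would form a
  proper ideal. A maximal ideal \<open>M\<close> above it contains a function \<open>g\<close> because \<open>\<phi> M\<close> is not large and
  the complementary function \<open>1 - g\<close> because that vanishes where \<open>\<phi>\<close> is large.
\<close>

lemma bounded_above_on_point_ideals:
  shows "\<exists>K. \<forall>x\<in>topspace X. \<phi> (point_ideal X x) \<le> K"
proof (rule ccontr)
  interpret cring "B1_ring X"
    by (rule cring_B1_ring)
  assume unbdd: "\<not> (\<exists>K. \<forall>x\<in>topspace X. \<phi> (point_ideal X x) \<le> K)"
  define I where "I = {k \<in> carrier (B1_ring X).
      \<exists>n. \<forall>x\<in>topspace X. n \<le> \<phi> (point_ideal X x) \<longrightarrow> k x = 0}"
  have "ideal I (B1_ring X)"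
  proof (rule idealI_mult)
    fix k l assume "k \<in> I" "l \<in> I"
    then obtain m n where kl: "k \<in> carrier (B1_ring X)" "l \<in> carrier (B1_ring X)"
        "\<forall>x\<in>topspace X. m \<le> \<phi> (point_ideal X x) \<longrightarrow> k x = 0"
        "\<forall>x\<in>topspace X. n \<le> \<phi> (point_ideal X x) \<longrightarrow> l x = 0"
      by (auto simp: I_def)
    then have "\<forall>x\<in>topspace X. max m n \<le> \<phi> (point_ideal X x) \<longrightarrow> (k \<oplus>\<^bsub>B1_ring X\<^esub> l) x = 0"
      by simp
    then show "k \<oplus>\<^bsub>B1_ring X\<^esub> l \<in> I"
      using add.m_closed[OF kl(1,2)] unfolding I_def by blast
  next
    fix k l assume k: "k \<in> I" and l: "l \<in> carrier (B1_ring X)"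
    then obtain n where "\<forall>x\<in>topspace X. n \<le> \<phi> (point_ideal X x) \<longrightarrow> k x = 0"
      by (auto simp: I_def)
    then have "\<forall>x\<in>topspace X. n \<le> \<phi> (point_ideal X x) \<longrightarrow> (l \<otimes>\<^bsub>B1_ring X\<^esub> k) x = 0"
      by simp
    moreover have "l \<otimes>\<^bsub>B1_ring X\<^esub> k \<in> carrier (B1_ring X)"
      using m_closed[OF l, of k] k unfolding I_def by blast
    ultimately show "l \<otimes>\<^bsub>B1_ring X\<^esub> k \<in> I"
      unfolding I_def by blast
  qed (auto simp: I_def)
  moreover have "\<one>\<^bsub>B1_ring X\<^esub> \<notin> I"
    using unbdd by (auto simp: I_def not_le) (metis less_asym)
  ultimately obtain M where M: "maximalideal M (B1_ring X)" "I \<subseteq> M"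
    using maximalideal_above by blast
  obtain g h where gh: "baire_one X h" "h \<in> extensional (topspace X)" "g \<in> M"
      "\<And>x. x \<in> topspace X \<Longrightarrow> g x + h x = 1"
      "\<And>x. x \<in> topspace X \<Longrightarrow> \<phi> M + 1 \<le> \<phi> (point_ideal X x) \<Longrightarrow> h x = 0"
    using separate_levels[of "\<phi> M" "\<phi> M + 1"] M(1) by (metis less_add_one order_refl)
  then have "h \<in> I"
    by (auto simp: I_def)
  then have "(\<lambda>x\<in>topspace X. g x + h x) \<in> M"
    using maximalideal_add_mem[OF M(1) gh(3)] M(2) by blast
  moreover have "(\<lambda>x\<in>topspace X. g x + h x) = (\<lambda>x\<in>topspace X. 1)"
    using gh(4) by (rule restrict_ext)
  ultimately show False
    using maximalideal_one_notin[OF M(1)] by simp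
qed

end

text \<open>The lower bound is the upper bound for \<open>- \<phi>\<close>.\<close>

lemma bounded_on_point_ideals:
  assumes \<phi>: "continuous_map (maximal_ideal_space (B1_ring X)) euclideanreal \<phi>"
  shows "bounded ((\<lambda>x. \<phi> (point_ideal X x)) ` topspace X)"
proof -
  obtain K where "\<forall>x\<in>topspace X. \<phi> (point_ideal X x) \<le> K"
    using bounded_above_on_point_ideals[OF \<phi>] by blast
  moreover obtain L where "\<forall>x\<in>topspace X. - \<phi> (point_ideal X x) \<le> L"
    using bounded_above_on_point_ideals[OF continuous_map_minus[OF \<phi>]] by blast
  ultimately have "\<forall>x\<in>topspace X. \<bar>\<phi> (point_ideal X x)\<bar> \<le> max K L"
    by fastforce
  then show ?thesis
    by (auto simp: bounded_iff)
qed

text \<open>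
  The functions \<open>g\<close> obtained from \<open>separate_levels\<close> for \<open>\<phi>\<close> also separate the levels of its values on
  \<open>X\<close>, and for a bounded function this is enough to be Baire one.
\<close>

lemma baire_one_on_point_ideals:
  assumes \<phi>: "continuous_map (maximal_ideal_space (B1_ring X)) euclideanreal \<phi>"
  shows "baire_one X (\<lambda>x. \<phi> (point_ideal X x))"
proof (rule baire_one_if_levels_separated)
  show "bounded ((\<lambda>x. \<phi> (point_ideal X x)) ` topspace X)"
    by (rule bounded_on_point_ideals[OF \<phi>])
  fix a b :: real assume "a < b"
  then obtain g h where gh: "baire_one X g"
    "\<And>x. x \<in> topspace X \<Longrightarrow> g x + h x = 1"
    "\<And>x. x \<in> topspace X \<Longrightarrow> \<phi> (point_ideal X x) \<le> a \<Longrightarrow> g x = 0"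
    "\<And>x. x \<in> topspace X \<Longrightarrow> b \<le> \<phi> (point_ideal X x) \<Longrightarrow> h x = 0"
    using separate_levels[OF \<phi>, of a b] by metis
  then have "\<forall>x\<in>topspace X. (\<phi> (point_ideal X x) \<le> a \<longrightarrow> g x = 0) \<and>
      (b \<le> \<phi> (point_ideal X x) \<longrightarrow> g x = 1)"
    by force
  then show "\<exists>g. baire_one X g \<and> (\<forall>x\<in>topspace X. (\<phi> (point_ideal X x) \<le> a \<longrightarrow> g x = 0) \<and>
      (b \<le> \<phi> (point_ideal X x) \<longrightarrow> g x = 1))"
    using gh(1) by blast
qed

section \<open>The isomorphism\<close>

text \<open>
  Evaluation at the point ideals is the direction in which the ring operations are preserved by
  computation; its inverse takes limits along the zero-set filters.
\<close>

lemma C_ring_iso_B1_bounded_ring: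
  "(\<lambda>\<phi>. \<lambda>x\<in>topspace X. \<phi> (point_ideal X x)) \<in>
    ring_iso (C_ring (maximal_ideal_space (B1_ring X))) (B1_bounded_ring X)"
proof (rule ring_iso_memI)
  let ?T = "maximal_ideal_space (B1_ring X)"
  let ?\<Phi> = "\<lambda>\<phi>. \<lambda>x\<in>topspace X. \<phi> (point_ideal X x)"
  have T: "topspace ?T = {M. maximalideal M (B1_ring X)}"
    by (rule cring.topspace_maximal_ideal_space[OF cring_B1_ring])
  have C: "\<phi> \<in> carrier (C_ring ?T) \<longleftrightarrow> \<phi> \<in> extensional (topspace ?T) \<and> continuous_map ?T euclideanreal \<phi>"
    for \<phi>
    by (simp add: C_ring_def fun_ring_def)
  have B: "f \<in> carrier (B1_bounded_ring X) \<longleftrightarrow>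
      f \<in> extensional (topspace X) \<and> baire_one X f \<and> bounded (f ` topspace X)" for f
    by (simp add: B1_bounded_ring_def fun_ring_def)
  show closed: "?\<Phi> \<phi> \<in> carrier (B1_bounded_ring X)" if "\<phi> \<in> carrier (C_ring ?T)" for \<phi>
    using that bounded_on_point_ideals[of X \<phi>] baire_one_on_point_ideals[of X \<phi>] by (simp add: B C)
  show "?\<Phi> (\<phi> \<otimes>\<^bsub>C_ring ?T\<^esub> \<psi>) = ?\<Phi> \<phi> \<otimes>\<^bsub>B1_bounded_ring X\<^esub> ?\<Phi> \<psi>"
    "?\<Phi> (\<phi> \<oplus>\<^bsub>C_ring ?T\<^esub> \<psi>) = ?\<Phi> \<phi> \<oplus>\<^bsub>B1_bounded_ring X\<^esub> ?\<Phi> \<psi>" for \<phi> \<psi>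
    by (auto simp: C_ring_def B1_bounded_ring_def fun_ring_def T maximalideal_point_ideal)
  show "?\<Phi> \<one>\<^bsub>C_ring ?T\<^esub> = \<one>\<^bsub>B1_bounded_ring X\<^esub>"
    by (auto simp: C_ring_def B1_bounded_ring_def fun_ring_def T maximalideal_point_ideal)
  show "bij_betw ?\<Phi> (carrier (C_ring ?T)) (carrier (B1_bounded_ring X))"
  proof (rule bij_betw_byWitness[where f' = "ideal_limit X"])
    show "\<forall>\<phi>\<in>carrier (C_ring ?T). ideal_limit X (?\<Phi> \<phi>) = \<phi>"
    proof
      fix \<phi> assume "\<phi> \<in> carrier (C_ring ?T)"
      then have \<phi>: "\<phi> \<in> extensional (topspace ?T)" "continuous_map ?T euclideanreal \<phi>"
        by (auto simp: C)
      have "ideal_limit X (?\<Phi> \<phi>) M = \<phi> M" if M: "maximalideal M (B1_ring X)" for M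
      proof (rule ideal_limit_eqI[OF M])
        have "eventually (\<lambda>x. \<phi> (point_ideal X x) = ?\<Phi> \<phi> x) (zero_filter X M)"
          using eventually_in_topspace[OF M] by eventually_elim simp
        then show "(?\<Phi> \<phi> \<longlongrightarrow> \<phi> M) (zero_filter X M)"
          by (rule Lim_transform_eventually[OF tendsto_at_maximalideal[OF \<phi>(2) M]])
      qed
      then show "ideal_limit X (?\<Phi> \<phi>) = \<phi>"
        using \<phi>(1) by (intro extensionalityI[of _ "topspace ?T"]) (auto simp: T ideal_limit_def)
    qed
    show "\<forall>f\<in>carrier (B1_bounded_ring X). ?\<Phi> (ideal_limit X f) = f"
      by (auto simp: B ideal_limit_point_ideal intro!: extensionalityI[of _ "topspace X"])
    show "?\<Phi> ` carrier (C_ring ?T) \<subseteq> carrier (B1_bounded_ring X)"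
      using closed by blast
    show "ideal_limit X ` carrier (B1_bounded_ring X) \<subseteq> carrier (C_ring ?T)"
      by (auto simp: B C continuous_map_ideal_limit) (simp add: ideal_limit_def T)
  qed
qed

theorem theorem4p8:
  fixes X :: "'a topology"
  assumes "T4_space X"
  shows "B1_bounded_ring X \<simeq> C_ring (maximal_ideal_space (B1_ring X)) \<and>
         C_type_ring TYPE(('a \<Rightarrow> real) set) (B1_bounded_ring X)"
proof -
  have "C_ring (maximal_ideal_space (B1_ring X)) \<simeq> B1_bounded_ring X"
    using C_ring_iso_B1_bounded_ring unfolding is_ring_iso_def by blast
  then have "B1_bounded_ring X \<simeq> C_ring (maximal_ideal_space (B1_ring X))"
    using ring_iso_sym cring.axioms(1)[OF cring_C_ring] by blast
  then show ?thesis
    unfolding C_type_ring_def by blast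
qed

end
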